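(* Let $\alpha>0$ and $n>0$. For $j=1,2,3,\dots$ let $$ \lambda_{j,+}=-\frac{\alpha+n(j\pi)^2}{2}+\frac12\sqrt{\big(\alpha+n(j\pi)^2\big)^2+4\alpha(j\pi)^2} $$ be the positive eigenvalue of the matrix $$ \begin{pmatrix}-n(j\pi)^2&\alpha(j\pi)^2\\ n+1&-\alpha\end{pmatrix}. $$ Then $\lambda_{j,+}$ satisfies the following properties: (1) $\lambda_{j,+}$ is increasing in $j$; (2) $\lambda_{j,+}<\frac{\alpha}{n}$; (3) $\lambda_{j,+}\to\frac{\alpha}{n}$ as $j\to\infty$.
   Context: The matrix governs the $j$-th cosine Fourier mode of the system $\partial_\tau\hat u=n\hat u_{xx}-\alpha\hat\theta_{xx}$, $\partial_\tau\hat\theta=(n+1)\hat u-\alpha\hat\theta$ on $0<x<1$ with homogeneous Neumann boundary conditions. Its two eigenvalues are real, one negative and one positive. *)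

theory Defs
  imports Complex_Main "Jordan_Normal_Form.Char_Poly"
begin

definition mode_matrix :: "real \<Rightarrow> real \<Rightarrow> nat \<Rightarrow> real mat" where
  "mode_matrix \<alpha> n j = mat_of_rows_list 2
     [[- n * (real j * pi)\<^sup>2, \<alpha> * (real j * pi)\<^sup>2],
      [n + 1, - \<alpha>]]"

definition lambda_plus :: "real \<Rightarrow> real \<Rightarrow> nat \<Rightarrow> real" where
  "lambda_plus \<alpha> n j =
     - ((\<alpha> + n * (real j * pi)\<^sup>2) / 2)
     + 1 / 2 * sqrt ((\<alpha> + n * (real j * pi)\<^sup>2)\<^sup>2 + 4 * \<alpha> * (real j * pi)\<^sup>2)"

end

theory Submission
  imports Defs
begin

text \<open>With \<open>m = (j\<pi>)\<^sup>2\<close>, the characteristic equation is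
  \<open>x\<^sup>2 + \<alpha> x = m (\<alpha> - n x)\<close>. For a root \<open>x > 0\<close> the left-hand side is positive, which gives
  \<open>x < \<alpha> / n\<close>; the left-hand side increases and \<open>\<alpha> - n x\<close> decreases in \<open>x\<close>, which gives
  monotonicity in \<open>m\<close>; and as \<open>x\<close> stays bounded, \<open>\<alpha> - n x = (x\<^sup>2 + \<alpha> x) / m\<close> tends to \<open>0\<close>.\<close>

text \<open>Laplace expansion along column 0: both minors are 1 by 1, hence equal to their single
  entry.\<close>

lemma det_2_by_2:
  fixes A :: "'a :: comm_ring_1 mat"
  assumes "A \<in> carrier_mat 2 2"
  shows "det A = A $$ (0, 0) * A $$ (1, 1) - A $$ (0, 1) * A $$ (1, 0)"
proof -
  have dims: "dim_row A = 2" "dim_col A = 2"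
    using assms by auto
  have "det (mat_delete A i 0) = mat_delete A i 0 $$ (0, 0)" for i
    using mat_delete_carrier[of A 2 2 i 0] assms by (intro det_single) simp
  then have "cofactor A i 0 = (-1) ^ i * A $$ (if i = 0 then 1 else 0, 1)" for i
    by (simp add: cofactor_def mat_delete_def dims)
  moreover have "{..<2::nat} = {0, 1}"
    by auto
  ultimately show ?thesis
    by (simp add: laplace_expansion_column[OF assms, of 0] mult.commute)
qed

lemma mode_matrix_carrier: "mode_matrix \<alpha> n j \<in> carrier_mat 2 2"
  by (rule carrier_matI) (simp_all add: mode_matrix_def mat_of_rows_list_def)

text \<open>The entry \<open>n + 1\<close> makes the determinant of the matrix collapse to
  \<open>- \<alpha> * (real j * pi)\<^sup>2\<close>. Collecting the terms of the characteristic
  polynomial that contain \<open>(real j * pi)\<^sup>2\<close> on one side isolates the dependence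
  on \<open>j\<close>.\<close>

lemma eigenvalue_mode_matrix_iff:
  "eigenvalue (mode_matrix \<alpha> n j) k \<longleftrightarrow>
     k\<^sup>2 + \<alpha> * k = (real j * pi)\<^sup>2 * (\<alpha> - n * k)"
proof -
  have "det (char_matrix (mode_matrix \<alpha> n j) k) =
      k\<^sup>2 + \<alpha> * k - (real j * pi)\<^sup>2 * (\<alpha> - n * k)"
    by (subst det_2_by_2[OF char_matrix_closed[OF mode_matrix_carrier]],
        simp add: char_matrix_def mode_matrix_def mat_of_rows_list_def)
      (simp add: algebra_simps power2_eq_square)
  then show ?thesis
    using eigenvalue_det[OF mode_matrix_carrier] by simp
qed

text \<open>The two roots have product \<open>- c < 0\<close>, so exactly one of them is positive,
  whatever the sign of \<open>b\<close>.\<close>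

lemma positive_root_quadratic_iff:
  fixes b c x :: real
  assumes "c > 0"
  shows "x > 0 \<and> x\<^sup>2 + b * x = c \<longleftrightarrow> x = - (b / 2) + 1 / 2 * sqrt (b\<^sup>2 + 4 * c)"
proof
  assume x: "x > 0 \<and> x\<^sup>2 + b * x = c"
  then have "x * (x + b) > 0"
    using assms by (simp add: power2_eq_square algebra_simps)
  \<comment> \<open>With \<open>x > 0\<close> this gives \<open>2 * x + b > 0\<close>, which selects
    the positive square root below.\<close>
  then have "x + b > 0"
    using x zero_less_mult_pos by blast
  moreover have "(2 * x + b)\<^sup>2 = b\<^sup>2 + 4 * c"
    using x by (auto simp: power2_eq_square algebra_simps)
  ultimately have "sqrt (b\<^sup>2 + 4 * c) = 2 * x + b"
    using x by (intro real_sqrt_unique) auto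
  then show "x = - (b / 2) + 1 / 2 * sqrt (b\<^sup>2 + 4 * c)"
    by (simp add: field_simps)
next
  assume x: "x = - (b / 2) + 1 / 2 * sqrt (b\<^sup>2 + 4 * c)"
  \<comment> \<open>The left side is \<open>\<bar>b\<bar>\<close>, so this dominates
    \<open>b\<close> for either sign.\<close>
  have "sqrt (b\<^sup>2) < sqrt (b\<^sup>2 + 4 * c)"
    using assms by (intro real_sqrt_less_mono) simp
  then have "x > 0"
    using x by simp
  moreover have "(2 * x + b)\<^sup>2 = b\<^sup>2 + 4 * c"
    using x assms by simp
  then have "x\<^sup>2 + b * x = c"
    by (simp add: power2_eq_square algebra_simps)
  ultimately show "x > 0 \<and> x\<^sup>2 + b * x = c" ..
qed

context
  fixes \<alpha> n :: real
  assumes \<alpha>: "\<alpha> > 0" and n: "n > 0"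
begin

text \<open>From here on the root equation replaces the closed formula. At \<open>j = 0\<close> the
  formula gives 0, so positivity needs \<open>j \<ge> 1\<close>.\<close>

lemma eq_lambda_plus_iff:
  assumes "j \<ge> 1"
  shows "k = lambda_plus \<alpha> n j \<longleftrightarrow>
    k > 0 \<and> k\<^sup>2 + \<alpha> * k = (real j * pi)\<^sup>2 * (\<alpha> - n * k)"
proof -
  have "\<alpha> * (real j * pi)\<^sup>2 > 0"
    using assms \<alpha> by simp
  from positive_root_quadratic_iff[OF this, of k "\<alpha> + n * (real j * pi)\<^sup>2"] show ?thesis
    by (auto simp: lambda_plus_def algebra_simps)
qed

lemma lambda_plus_pos: "j \<ge> 1 \<Longrightarrow> lambda_plus \<alpha> n j > 0"
  and lambda_plus_root: "j \<ge> 1 \<Longrightarrow> (lambda_plus \<alpha> n j)\<^sup>2 + \<alpha> * lambda_plus \<alpha> n j =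
    (real j * pi)\<^sup>2 * (\<alpha> - n * lambda_plus \<alpha> n j)"
  using eq_lambda_plus_iff by blast+

lemma lambda_plus_factor_pos:
  assumes "j \<ge> 1"
  shows "\<alpha> - n * lambda_plus \<alpha> n j > 0"
proof -
  have "(real j * pi)\<^sup>2 * (\<alpha> - n * lambda_plus \<alpha> n j) > 0"
    using lambda_plus_pos[OF assms] \<alpha>
    by (simp flip: lambda_plus_root[OF assms] add: add_pos_pos)
  then show ?thesis
    by (rule zero_less_mult_pos) (use assms in simp)
qed

lemma lambda_plus_less:
  assumes "j \<ge> 1"
  shows "lambda_plus \<alpha> n j < \<alpha> / n"
  using lambda_plus_factor_pos[OF assms] n by (simp add: field_simps)

lemma strict_mono_on_lambda_plus: "strict_mono_on {1..} (lambda_plus \<alpha> n)"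
proof (rule strict_mono_onI)
  fix i j :: nat
  assume "i \<in> {1..}" and "i < j"
  then have i: "i \<ge> 1" and j: "j \<ge> 1" by auto
  let ?x = "lambda_plus \<alpha> n i" and ?y = "lambda_plus \<alpha> n j"
  show "?x < ?y"
  proof (rule ccontr)
    assume "\<not> ?x < ?y"
    then have le: "?y \<le> ?x" by simp
    \<comment> \<open>The chain starting here returns to its first term; its one strict step comes
      from \<open>i < j\<close> and the positive factor \<open>\<alpha> - n * ?x\<close>.\<close>
    have "?y\<^sup>2 + \<alpha> * ?y \<le> ?x\<^sup>2 + \<alpha> * ?x"
      using le lambda_plus_pos[OF j] \<alpha> by (intro add_mono power_mono mult_left_mono) auto
    also have "\<dots> = (real i * pi)\<^sup>2 * (\<alpha> - n * ?x)"
      by (rule lambda_plus_root[OF i])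
    also have "\<dots> < (real j * pi)\<^sup>2 * (\<alpha> - n * ?x)"
      using \<open>i < j\<close> lambda_plus_factor_pos[OF i]
      by (intro mult_strict_right_mono power_strict_mono) auto
    also have "\<dots> \<le> (real j * pi)\<^sup>2 * (\<alpha> - n * ?y)"
      using le n by (intro mult_left_mono) auto
    also have "\<dots> = ?y\<^sup>2 + \<alpha> * ?y"
      by (rule lambda_plus_root[OF j, symmetric])
    finally show False by simp
  qed
qed

lemma lambda_plus_tendsto: "lambda_plus \<alpha> n \<longlonglongrightarrow> \<alpha> / n"
proof (rule tendsto_sandwich)
  \<comment> \<open>Bounding the left side of the root equation by its value at
    \<open>\<alpha> / n\<close> and dividing by \<open>n * (real j * pi)\<^sup>2\<close> yields an
    error of order \<open>1 / j\<^sup>2\<close> with this constant.\<close>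
  define C where "C = ((\<alpha> / n)\<^sup>2 + \<alpha> * (\<alpha> / n)) / (n * pi\<^sup>2)"
  \<comment> \<open>The bound fails at \<open>j = 0\<close>, where \<open>1 / real j\<close> is 0
    and it would read \<open>\<alpha> / n \<le> 0\<close>.\<close>
  show "\<forall>\<^sub>F j in sequentially. \<alpha> / n - C * (1 / real j)\<^sup>2 \<le> lambda_plus \<alpha> n j"
    using eventually_ge_at_top[of 1]
  proof eventually_elim
    fix j :: nat
    assume j: "1 \<le> j"
    let ?x = "lambda_plus \<alpha> n j"
    have "(n * pi\<^sup>2 * (real j)\<^sup>2) * (\<alpha> / n - ?x) = (real j * pi)\<^sup>2 * (\<alpha> - n * ?x)"
      using n by (simp add: power_mult_distrib right_diff_distrib)
    also have "\<dots> = ?x\<^sup>2 + \<alpha> * ?x"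
      by (rule lambda_plus_root[OF j, symmetric])
    also have "\<dots> \<le> (\<alpha> / n)\<^sup>2 + \<alpha> * (\<alpha> / n)"
      using lambda_plus_pos[OF j] lambda_plus_less[OF j] \<alpha>
      by (intro add_mono power_mono mult_left_mono) auto
    also have "\<dots> = (n * pi\<^sup>2 * (real j)\<^sup>2) * (C * (1 / real j)\<^sup>2)"
      using n j by (simp add: C_def power_divide)
    finally have "\<alpha> / n - ?x \<le> C * (1 / real j)\<^sup>2"
      by (rule mult_left_le_imp_le) (use n j in simp)
    then show "\<alpha> / n - C * (1 / real j)\<^sup>2 \<le> ?x"
      by simp
  qed
  show "\<forall>\<^sub>F j in sequentially. lambda_plus \<alpha> n j \<le> \<alpha> / n"
    using eventually_ge_at_top[of 1] by eventually_elim (rule less_imp_le[OF lambda_plus_less])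
  have "(\<lambda>j. \<alpha> / n - C * (1 / real j)\<^sup>2) \<longlonglongrightarrow> \<alpha> / n - C * 0\<^sup>2"
    by (intro tendsto_intros lim_1_over_n)
  then show "(\<lambda>j. \<alpha> / n - C * (1 / real j)\<^sup>2) \<longlonglongrightarrow> \<alpha> / n"
    by simp
qed simp

end

theorem lemma3p1:
  fixes \<alpha> n :: real
  assumes "\<alpha> > 0" and "n > 0"
  shows "(\<forall>j\<ge>1. {k. eigenvalue (mode_matrix \<alpha> n j) k \<and> k > 0} = {lambda_plus \<alpha> n j}) \<and>
         strict_mono_on {1..} (lambda_plus \<alpha> n) \<and>
         (\<forall>j\<ge>1. lambda_plus \<alpha> n j < \<alpha> / n) \<and>
         (lambda_plus \<alpha> n) \<longlonglongrightarrow> \<alpha> / n"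
proof (intro conjI allI impI)
  fix j :: nat
  assume "1 \<le> j"
  then show "{k. eigenvalue (mode_matrix \<alpha> n j) k \<and> k > 0} = {lambda_plus \<alpha> n j}"
    using eq_lambda_plus_iff[OF assms] by (auto simp: eigenvalue_mode_matrix_iff)
next
  show "strict_mono_on {1..} (lambda_plus \<alpha> n)"
    by (rule strict_mono_on_lambda_plus[OF assms])
next
  fix j :: nat
  assume "1 \<le> j"
  then show "lambda_plus \<alpha> n j < \<alpha> / n"
    by (rule lambda_plus_less[OF assms])
next
  show "lambda_plus \<alpha> n \<longlonglongrightarrow> \<alpha> / n"
    by (rule lambda_plus_tendsto[OF assms])
qed

end
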